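(* (Taylor formula in $(\sigma,\tau)$-quantum calculus.) Let $M,\sigma,\tau,\theta,D$, the basis $\{\zeta_s\}_{s\in S}$ of $Z(D)$, the points $\{q_s\}_{s\in S}$, the functions $\Lambda_{q_ss}^{(k)}$, the spaces $V_s(D)$, the projections $\pi_s$ and the operators $R,F$ be as in the context. Let $n\in\mathbb N_0$ and let $W\in\ker D^{n+1}\setminus\ker D^{n}$, i.e. $W$ is a $D$-polynomial of degree $n$. For $k=0,\dots,n$ let $S_W^k\subset S$ be a finite subset such that $FD^kW=\sum_{s\in S_W^k}\lambda_{ks}\zeta_s$ with real coefficients $\lambda_{ks}$ (put $\lambda_{ks}=0$ for $s\notin S_W^k$), let $S_W=\bigcup_{k=0}^nS_W^k$, and put $W_s=\pi_s(W)$. Then $W=\sum_{s\in S_W}W_s$, the coefficients are $\lambda_{ks}=(D^kW_s)(q_s)$, and $$W_s=\sum_{k=0}^{n}(D^kW_s)(q_s)\,\Lambda_{q_ss}^{(k)}\qquad\text{for every } s\in S_W,$$ $$W=\sum_{s\in S_W}\sum_{k=0}^{n}(D^kW_s)(q_s)\,\Lambda_{q_ss}^{(k)}.$$ In particular, if $W\in V_s(D)$ for some $s\in S$, then $W=\sum_{k=0}^{n}(D^kW)(q_s)\,\Lambda_{q_ss}^{(k)}$.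
   Context: $\mathbb N=\{1,2,\dots\}$, $\mathbb N_0=\{0,1,2,\dots\}$. $M$ is a set. A tension function is a function $\theta:M\times M\to\mathbb R$ with $\theta(p_1,p_2)+\theta(p_2,p_3)=\theta(p_1,p_3)$ for all $p_1,p_2,p_3\in M$; write $\theta_q(p)=\theta(p,q)$. The maps $\sigma,\tau:M\to M$ commute, $\theta$ is a tension function with $\theta(\tau(p),\sigma(p))\ne0$ for all $p\in M$, and $\theta$ is homogeneous with respect to $\sigma$ and $\tau$: there are real numbers $s_0,t_0$ with $\theta(\sigma(p_1),\sigma(p_2))=s_0\,\theta(p_1,p_2)$ and $\theta(\tau(p_1),\tau(p_2))=t_0\,\theta(p_1,p_2)$ for all $p_1,p_2\in M$. The $(\sigma,\tau)$-quantum derivative $D$ acts on $X=\mathbb R^M$ by $Df(p)=\dfrac{f(\tau(p))-f(\sigma(p))}{\theta(\tau(p),\sigma(p))}$; $D^0$ is the identity. Put $[n]=\sum_{k=1}^{n}t_0^{\,n-k}s_0^{\,k-1}$ for $n\in\mathbb N$, $[0]!=1$, $[n]!=[n]\cdot[n-1]!$. For $q\in M$ define $\theta_q^{(0)}=1$ (constant function) and $\theta_q^{(m)}=\prod_{k=1}^{m}\theta_{\tau^{m-k}\sigma^{k-1}(q)}$ for $m\in\mathbb N$. Let $\{\zeta_s\}_{s\in S}$ be a basis of $Z(D)=\ker D$. With any such basis one associates a family of points $\{q_s\}_{s\in S}\subset M$ such that $\zeta_s(q_s)\neq0$ and $\zeta_{s_1}(q_{s_2})=0$ for $s_1\neq s_2$,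 and normalizes the basis so that $\zeta_s(q_s)=1$ and $\zeta_s(q_t)=0$ for $s\ne t$. Define $\zeta_{q_ss}^{(k)}=\frac1{[k]!}(\zeta_s\circ\sigma^{-k})\cdot\theta_{q_s}^{(k)}$ for $s\in S$, $k\in\mathbb N_0$ ($\sigma^{-k}$ being the $k$-th iterate of the inverse of $\sigma$), and recursively $\Lambda_{q_ss}^{(0)}=\zeta_s$, $$\Lambda_{q_ss}^{(m)}=\zeta_{q_ss}^{(m)}-\sum_{i=0}^{m-1}\zeta_{q_ss}^{(m-i)}(q_s)\,\Lambda_{q_ss}^{(i)},\qquad m\in\mathbb N.$$ For $m\in\mathbb N_0$, a $D$-polynomial of degree $m$ is an element of $\ker D^{m+1}\setminus\ker D^m$, and $P(D)=\bigcup_{k\ge0}\ker D^k$. Put $V_s(D)=\operatorname{Lin}\{\Lambda_{q_ss}^{(m)}:m\in\mathbb N_0\}$; one has $P(D)=\bigoplus_{s\in S}V_s(D)$, and $\pi_s:P(D)\to V_s(D)$ denotes the projection associated with this direct sum. $R$ is a right inverse of $D$ ($DR=I$) given on $P(D)$ by $R\Lambda_{q_ss}^{(m)}=\Lambda_{q_ss}^{(m+1)}$ for all $s\in S$, $m\in\mathbb N_0$ (and defined arbitrarily, as a right inverse, on a linear complement of $P(D)$ in $X$), and $F=I-RD$ is the corresponding initial operator, a projection onto $Z(D)$. *)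

theory Defs
  imports Complex_Main "HOL-Library.Function_Algebras"
begin

text \<open>The pointwise real vector space structure on functions, so that the library notions
  \<open>linear\<close>, \<open>span\<close> and \<open>independent\<close> apply to the space of real functions on \<open>M\<close>. The set \<open>M\<close>
  is rendered as the type \<open>'m\<close>.\<close>

instantiation "fun" :: (type, real_vector) real_vector
begin

definition scaleR_fun :: "real \<Rightarrow> ('a \<Rightarrow> 'b) \<Rightarrow> 'a \<Rightarrow> 'b"
  where "scaleR_fun c f = (\<lambda>x. c *\<^sub>R f x)"

instance
  by standard (simp_all add: scaleR_fun_def fun_eq_iff algebra_simps)

end

definition tension :: "('m \<Rightarrow> 'm \<Rightarrow> real) \<Rightarrow> bool" where
  "tension \<theta> \<longleftrightarrow> (\<forall>p1 p2 p3. \<theta> p1 p2 + \<theta> p2 p3 = \<theta> p1 p3)"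

definition homogeneous :: "('m \<Rightarrow> 'm \<Rightarrow> real) \<Rightarrow> ('m \<Rightarrow> 'm) \<Rightarrow> real \<Rightarrow> bool" where
  "homogeneous \<theta> \<sigma> c \<longleftrightarrow> (\<forall>p1 p2. \<theta> (\<sigma> p1) (\<sigma> p2) = c * \<theta> p1 p2)"

definition qderiv ::
  "('m \<Rightarrow> 'm) \<Rightarrow> ('m \<Rightarrow> 'm) \<Rightarrow> ('m \<Rightarrow> 'm \<Rightarrow> real) \<Rightarrow> ('m \<Rightarrow> real) \<Rightarrow> 'm \<Rightarrow> real" where
  "qderiv \<sigma> \<tau> \<theta> f p = (f (\<tau> p) - f (\<sigma> p)) / \<theta> (\<tau> p) (\<sigma> p)"

definition kernel :: "('a \<Rightarrow> 'b::zero) \<Rightarrow> 'a set" where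
  "kernel L = {f. L f = 0}"

definition qnum :: "real \<Rightarrow> real \<Rightarrow> nat \<Rightarrow> real" where
  "qnum s0 t0 n = (\<Sum>k=1..n. t0 ^ (n - k) * s0 ^ (k - 1))"

primrec qfact :: "real \<Rightarrow> real \<Rightarrow> nat \<Rightarrow> real" where
  "qfact s0 t0 0 = 1"
| "qfact s0 t0 (Suc n) = qnum s0 t0 (Suc n) * qfact s0 t0 n"

definition theta_pow ::
  "('m \<Rightarrow> 'm) \<Rightarrow> ('m \<Rightarrow> 'm) \<Rightarrow> ('m \<Rightarrow> 'm \<Rightarrow> real) \<Rightarrow> 'm \<Rightarrow> nat \<Rightarrow> 'm \<Rightarrow> real" where
  "theta_pow \<sigma> \<tau> \<theta> q m p = (\<Prod>k=1..m. \<theta> p ((\<tau> ^^ (m - k)) ((\<sigma> ^^ (k - 1)) q)))"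

text \<open>In the next two definitions \<open>z\<close> and \<open>q\<close> stand for a basis function \<open>\<zeta>\<^sub>s\<close> and its
  point \<open>q\<^sub>s\<close>. They are meaningful only if all \<open>qfact s0 t0 k\<close> are nonzero, as division by
  zero yields zero.\<close>

definition zeta_pow ::
  "('m \<Rightarrow> 'm) \<Rightarrow> ('m \<Rightarrow> 'm) \<Rightarrow> ('m \<Rightarrow> 'm \<Rightarrow> real) \<Rightarrow> real \<Rightarrow> real \<Rightarrow> ('m \<Rightarrow> real) \<Rightarrow> 'm
    \<Rightarrow> nat \<Rightarrow> 'm \<Rightarrow> real" where
  "zeta_pow \<sigma> \<tau> \<theta> s0 t0 z q k p =
     1 / qfact s0 t0 k * (z ((inv \<sigma> ^^ k) p) * theta_pow \<sigma> \<tau> \<theta> q k p)"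

fun Lambda ::
  "('m \<Rightarrow> 'm) \<Rightarrow> ('m \<Rightarrow> 'm) \<Rightarrow> ('m \<Rightarrow> 'm \<Rightarrow> real) \<Rightarrow> real \<Rightarrow> real \<Rightarrow> ('m \<Rightarrow> real) \<Rightarrow> 'm
    \<Rightarrow> nat \<Rightarrow> 'm \<Rightarrow> real" where
  "Lambda \<sigma> \<tau> \<theta> s0 t0 z q 0 = z"
| "Lambda \<sigma> \<tau> \<theta> s0 t0 z q (Suc m) =
     zeta_pow \<sigma> \<tau> \<theta> s0 t0 z q (Suc m)
     - (\<Sum>i=0..m. zeta_pow \<sigma> \<tau> \<theta> s0 t0 z q (Suc m - i) q *\<^sub>R Lambda \<sigma> \<tau> \<theta> s0 t0 z q i)"

definition basis_family :: "'s set \<Rightarrow> ('s \<Rightarrow> 'v::real_vector) \<Rightarrow> 'v set \<Rightarrow> bool" where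
  "basis_family S \<zeta> Z \<longleftrightarrow> inj_on \<zeta> S \<and> independent (\<zeta> ` S) \<and> span (\<zeta> ` S) = Z"

text \<open>The projection \<open>\<pi>\<^sub>s\<close> of \<open>\<Oplus>\<^sub>s V\<^sub>s\<close> onto \<open>V\<^sub>s\<close>: the \<open>s\<close>-entry of the unique finitely supported
  family \<open>u\<close> with \<open>u\<^sub>s \<in> V\<^sub>s\<close> that sums up to \<open>w\<close>. It is meaningful if the sum of the \<open>V\<^sub>s\<close> is
  direct and contains \<open>w\<close>.\<close>

definition direct_sum_proj ::
  "'s set \<Rightarrow> ('s \<Rightarrow> 'v::real_vector set) \<Rightarrow> 's \<Rightarrow> 'v \<Rightarrow> 'v" where
  "direct_sum_proj S V s w =
     (THE u. (\<forall>t\<in>S. u t \<in> V t) \<and> (\<forall>t. t \<notin> S \<longrightarrow> u t = 0) \<and>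
             finite {t \<in> S. u t \<noteq> 0} \<and> w = (\<Sum>t\<in>{t \<in> S. u t \<noteq> 0}. u t)) s"

definition right_inverse :: "('v::real_vector \<Rightarrow> 'v) \<Rightarrow> ('v \<Rightarrow> 'v) \<Rightarrow> bool" where
  "right_inverse D R \<longleftrightarrow> linear R \<and> (\<forall>f. D (R f) = f)"

definition initial_op :: "('v::real_vector \<Rightarrow> 'v) \<Rightarrow> ('v \<Rightarrow> 'v) \<Rightarrow> 'v \<Rightarrow> 'v" where
  "initial_op D R f = f - R (D f)"

end

theory Submission
  imports Defs
begin

text \<open>Since \<open>D R = I\<close>, each \<open>\<Lambda>\<^sub>s\<close> is a Jordan chain of \<open>D\<close> starting in \<open>ker D\<close>, and the
  subtraction in the recursion for \<open>\<Lambda>\<^sub>s\<close> makes all of its members except \<open>\<zeta>\<^sub>s\<close> vanish at \<open>q\<^sub>s\<close>.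
  Hence the functionals \<open>u \<mapsto> (D\<^sup>k u)(q\<^sub>s)\<close> are dual to the chain, which gives the Taylor
  formula on \<open>V\<^sub>s\<close>. The sum of the \<open>V\<^sub>s\<close> is direct: \<open>D\<close> maps a vanishing combination to one
  of lower nilpotency order, so that only a combination of the \<open>\<zeta>\<^sub>s\<close> has to be excluded.
  Iterating \<open>I = F + R D\<close> gives \<open>W = \<Sum>\<^sub>k R\<^sup>k F D\<^sup>k W\<close>, which exhibits the components
  \<open>\<pi>\<^sub>s W\<close>.\<close>

section \<open>Linear operators and their iterates\<close>

lemma linear_fun_apply: "linear (\<lambda>f. f x)"
  by (rule linearI) (simp_all add: scaleR_fun_def)

lemma linear_qderiv: "linear (qderiv \<sigma> \<tau> \<theta>)"
  by (rule linearI)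
    (simp_all add: qderiv_def scaleR_fun_def fun_eq_iff add_diff_add add_divide_distrib
      flip: right_diff_distrib)

lemma linear_funpow:
  fixes L :: "'v::real_vector \<Rightarrow> 'v"
  assumes "linear L"
  shows "linear (L ^^ k)"
proof (induction k)
  case 0
  show ?case by (simp add: linear_id flip: id_def)
next
  case (Suc k)
  show ?case using linear_compose[OF Suc assms] by (simp add: comp_def)
qed

lemma linear_funpow_eq_0_mono:
  fixes L :: "'v::real_vector \<Rightarrow> 'v"
  assumes "linear L" "(L ^^ m) v = 0" "m \<le> n"
  shows "(L ^^ n) v = 0"
proof -
  have "(L ^^ n) v = (L ^^ (n - m)) ((L ^^ m) v)"
    using assms(3) by (simp flip: funpow_add comp_apply[of "L ^^ (n - m)"])
  then show ?thesis
    using assms(1,2) by (simp add: linear_0 linear_funpow)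
qed

lemma funpow_initial_op_expansion:
  fixes D R :: "'v::real_vector \<Rightarrow> 'v"
  assumes "linear R"
  shows "w = (\<Sum>k<n. (R ^^ k) (initial_op D R ((D ^^ k) w))) + (R ^^ n) ((D ^^ n) w)"
proof (induction n)
  case 0
  show ?case by simp
next
  case (Suc n)
  have "(R ^^ n) ((D ^^ n) w)
      = (R ^^ n) (initial_op D R ((D ^^ n) w)) + (R ^^ Suc n) ((D ^^ Suc n) w)"
    by (simp add: initial_op_def linear_diff[OF linear_funpow[OF assms]] funpow_swap1)
  then show ?case
    using Suc by (simp add: add.assoc)
qed

section \<open>Projections of direct sums\<close>

definition independent_subspaces :: "'s set \<Rightarrow> ('s \<Rightarrow> 'v::real_vector set) \<Rightarrow> bool" where
  "independent_subspaces S V \<longleftrightarrow> (\<forall>s\<in>S. subspace (V s)) \<and>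
     (\<forall>T u. finite T \<longrightarrow> T \<subseteq> S \<longrightarrow> (\<forall>t\<in>T. u t \<in> V t) \<longrightarrow> (\<Sum>t\<in>T. u t) = 0 \<longrightarrow> (\<forall>t\<in>T. u t = 0))"

lemma independent_subspacesD:
  assumes "independent_subspaces S V" "finite T" "T \<subseteq> S"
    and "\<And>t. t \<in> T \<Longrightarrow> u t \<in> V t" "(\<Sum>t\<in>T. u t) = 0" "s \<in> T"
  shows "u s = 0"
  using assms by (simp add: independent_subspaces_def)

definition direct_sum_decomposition ::
  "'s set \<Rightarrow> ('s \<Rightarrow> 'v::real_vector set) \<Rightarrow> 'v \<Rightarrow> ('s \<Rightarrow> 'v) \<Rightarrow> bool" where
  "direct_sum_decomposition S V w u \<longleftrightarrow> (\<forall>t\<in>S. u t \<in> V t) \<and> (\<forall>t. t \<notin> S \<longrightarrow> u t = 0) \<and>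
     finite {t \<in> S. u t \<noteq> 0} \<and> w = (\<Sum>t\<in>{t \<in> S. u t \<noteq> 0}. u t)"

lemma direct_sum_decompositionI:
  assumes "finite T" "T \<subseteq> S" "\<And>t. t \<in> S \<Longrightarrow> u t \<in> V t" "\<And>t. t \<notin> T \<Longrightarrow> u t = 0" "w = (\<Sum>t\<in>T. u t)"
  shows "direct_sum_decomposition S V w u"
proof -
  have "{t \<in> S. u t \<noteq> 0} \<subseteq> T"
    using assms(4) by auto
  moreover from this have "w = (\<Sum>t\<in>{t \<in> S. u t \<noteq> 0}. u t)"
    unfolding assms(5) by (intro sum.mono_neutral_right) (use assms(1,2) in auto)
  ultimately show ?thesis
    using assms by (auto simp: direct_sum_decomposition_def intro: finite_subset)
qed

lemma direct_sum_decomposition_unique: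
  assumes V: "independent_subspaces S V"
    and u: "direct_sum_decomposition S V w u" and v: "direct_sum_decomposition S V w v"
  shows "u = v"
proof
  let ?T = "{t \<in> S. u t \<noteq> 0} \<union> {t \<in> S. v t \<noteq> 0}"
  have T: "finite ?T" "?T \<subseteq> S"
    using u v by (auto simp: direct_sum_decomposition_def)
  have "(\<Sum>t\<in>?T. u t) = (\<Sum>t\<in>{t \<in> S. u t \<noteq> 0}. u t)"
    by (rule sum.mono_neutral_right) (use T in auto)
  moreover have "(\<Sum>t\<in>?T. v t) = (\<Sum>t\<in>{t \<in> S. v t \<noteq> 0}. v t)"
    by (rule sum.mono_neutral_right) (use T in auto)
  ultimately have "(\<Sum>t\<in>?T. u t - v t) = 0"
    using u v by (simp add: direct_sum_decomposition_def sum_subtractf)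
  moreover have "u t - v t \<in> V t" if "t \<in> ?T" for t
  proof (rule subspace_diff)
    show "subspace (V t)" "u t \<in> V t" "v t \<in> V t"
      using V u v that by (auto simp: independent_subspaces_def direct_sum_decomposition_def)
  qed
  ultimately have "u t - v t = 0" if "t \<in> ?T" for t
    using independent_subspacesD[OF V T, of "\<lambda>t. u t - v t"] that by blast
  then show "u t = v t" for t
    using u v unfolding direct_sum_decomposition_def by (cases "t \<in> ?T") auto
qed

lemma direct_sum_proj_eq:
  assumes "independent_subspaces S V" "direct_sum_decomposition S V w u"
  shows "direct_sum_proj S V s w = u s"
proof -
  have "(THE u. direct_sum_decomposition S V w u) = u"
    using assms direct_sum_decomposition_unique by blast
  then show ?thesis
    by (simp add: direct_sum_proj_def direct_sum_decomposition_def)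
qed

section \<open>Chains of a linear operator and dual functionals\<close>

locale dual_chains =
  fixes D :: "'v::real_vector \<Rightarrow> 'v"
    and S :: "'s set"
    and \<Lambda> :: "'s \<Rightarrow> nat \<Rightarrow> 'v"
    and \<epsilon> :: "'s \<Rightarrow> 'v \<Rightarrow> real"
  assumes linear_D: "linear D"
    and linear_functional: "s \<in> S \<Longrightarrow> linear (\<epsilon> s)"
    and D_chain_0: "s \<in> S \<Longrightarrow> D (\<Lambda> s 0) = 0"
    and D_chain_Suc: "s \<in> S \<Longrightarrow> D (\<Lambda> s (Suc m)) = \<Lambda> s m"
    and functional_chain: "s \<in> S \<Longrightarrow> \<epsilon> s (\<Lambda> s m) = (if m = 0 then 1 else 0)"
    and functional_other_chain_0: "s \<in> S \<Longrightarrow> t \<in> S \<Longrightarrow> s \<noteq> t \<Longrightarrow> \<epsilon> s (\<Lambda> t 0) = 0"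
begin

definition chain_space :: "'s \<Rightarrow> 'v set" where
  "chain_space s = span (range (\<Lambda> s))"

definition component :: "'s \<Rightarrow> 'v \<Rightarrow> 'v" where
  "component = direct_sum_proj S chain_space"

lemmas linear_funpow_D = linear_funpow[OF linear_D]

lemma linear_functional_funpow:
  assumes "s \<in> S"
  shows "linear (\<lambda>v. \<epsilon> s ((D ^^ k) v))"
  using linear_compose[OF linear_funpow_D linear_functional[OF assms]] by (simp add: comp_def)

lemma funpow_D_chain:
  assumes "s \<in> S"
  shows "(D ^^ k) (\<Lambda> s m) = (if k \<le> m then \<Lambda> s (m - k) else 0)"
proof (induction k)
  case 0
  show ?case by simp
next
  case (Suc k)
  show ?case
  proof (cases "m - k")
    case 0
    with Suc show ?thesis
      by (auto simp: D_chain_0[OF assms] linear_0[OF linear_D])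
  next
    case (Suc j)
    then have "k \<le> m" "Suc k \<le> m" "m - Suc k = j" by auto
    with Suc Suc.IH show ?thesis
      by (simp add: D_chain_Suc[OF assms])
  qed
qed

lemma functional_funpow_chain:
  assumes "s \<in> S"
  shows "\<epsilon> s ((D ^^ k) (\<Lambda> s m)) = (if k = m then 1 else 0)"
  using assms by (auto simp: funpow_D_chain functional_chain linear_0[OF linear_functional])

lemma functional_funpow_chain_sum:
  assumes "s \<in> S" "finite I"
  shows "\<epsilon> s ((D ^^ k) (\<Sum>i\<in>I. c i *\<^sub>R \<Lambda> s i)) = (if k \<in> I then c k else 0)"
  using assms
  by (simp add: linear_sum[OF linear_functional_funpow] linear_scale[OF linear_functional_funpow]
      functional_funpow_chain if_distrib[of "\<lambda>r. _ * r"] cong: if_cong)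

lemma chain_sum_in_chain_space: "(\<Sum>i\<in>I. c i *\<^sub>R \<Lambda> s i) \<in> chain_space s"
  by (simp add: chain_space_def span_sum span_scale span_base)

lemma D_in_chain_space:
  assumes "s \<in> S" "u \<in> chain_space s"
  shows "D u \<in> chain_space s"
  using assms(2) unfolding chain_space_def
proof (induction rule: span_induct_alt)
  case base
  show ?case by (simp add: linear_0[OF linear_D] span_zero)
next
  case (step a x y)
  then obtain m where "x = \<Lambda> s m" by auto
  then have "D x \<in> span (range (\<Lambda> s))"
    by (cases m) (simp_all add: D_chain_0 D_chain_Suc assms(1) span_zero span_base)
  with step show ?case
    by (simp add: linear_add[OF linear_D] linear_scale[OF linear_D] span_add span_scale)
qed

lemma eventually_chain_space_taylor:
  assumes "s \<in> S" "u \<in> chain_space s"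
  shows "\<forall>\<^sub>F n in sequentially. u = (\<Sum>k<n. \<epsilon> s ((D ^^ k) u) *\<^sub>R \<Lambda> s k)"
  using assms(2) unfolding chain_space_def
proof (induction rule: span_induct_alt)
  case base
  show ?case by (simp add: linear_0[OF linear_functional_funpow[OF assms(1)]])
next
  case (step a x y)
  then obtain m where x: "x = \<Lambda> s m" by auto
  have "\<forall>\<^sub>F n in sequentially. x = (\<Sum>k<n. \<epsilon> s ((D ^^ k) x) *\<^sub>R \<Lambda> s k)"
    using eventually_gt_at_top[of m]
    by eventually_elim
      (simp add: x functional_funpow_chain[OF assms(1)] if_distrib[of "\<lambda>r. r *\<^sub>R _"] cong: if_cong)
  with step.IH show ?case
  proof eventually_elim
    case (elim n)
    have "(\<Sum>k<n. \<epsilon> s ((D ^^ k) (a *\<^sub>R x + y)) *\<^sub>R \<Lambda> s k)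
        = a *\<^sub>R (\<Sum>k<n. \<epsilon> s ((D ^^ k) x) *\<^sub>R \<Lambda> s k) + (\<Sum>k<n. \<epsilon> s ((D ^^ k) y) *\<^sub>R \<Lambda> s k)"
      by (simp add: linear_add[OF linear_functional_funpow[OF assms(1)]]
          linear_scale[OF linear_functional_funpow[OF assms(1)]]
          scaleR_add_left scaleR_sum_right sum.distrib)
    then show ?case
      by (simp flip: elim)
  qed
qed

lemma chain_space_taylor:
  assumes "s \<in> S" "u \<in> chain_space s" "(D ^^ Suc n) u = 0"
  shows "u = (\<Sum>k\<le>n. \<epsilon> s ((D ^^ k) u) *\<^sub>R \<Lambda> s k)"
proof -
  have "\<forall>\<^sub>F N in sequentially. u = (\<Sum>k<N. \<epsilon> s ((D ^^ k) u) *\<^sub>R \<Lambda> s k) \<and> n < N"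
    using assms by (intro eventually_conj eventually_chain_space_taylor eventually_gt_at_top)
  then obtain N where N: "u = (\<Sum>k<N. \<epsilon> s ((D ^^ k) u) *\<^sub>R \<Lambda> s k)" "n < N"
    by (auto dest: eventually_happens)
  have "\<epsilon> s ((D ^^ k) u) = 0" if "n < k" for k
    using linear_funpow_eq_0_mono[OF linear_D assms(3), of k] that
    by (simp add: linear_0[OF linear_functional[OF assms(1)]])
  then have "(\<Sum>k<N. \<epsilon> s ((D ^^ k) u) *\<^sub>R \<Lambda> s k) = (\<Sum>k\<le>n. \<epsilon> s ((D ^^ k) u) *\<^sub>R \<Lambda> s k)"
    using N(2) by (intro sum.mono_neutral_right) auto
  with N(1) show ?thesis by simp
qed

lemma eventually_funpow_D_chain_space_eq_0:
  assumes "s \<in> S" "u \<in> chain_space s"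
  shows "\<forall>\<^sub>F n in sequentially. (D ^^ n) u = 0"
  using assms(2) unfolding chain_space_def
proof (induction rule: span_induct_alt)
  case base
  show ?case by (simp add: linear_0[OF linear_funpow_D])
next
  case (step a x y)
  then obtain m where x: "x = \<Lambda> s m" by auto
  show ?case
    using step.IH eventually_gt_at_top[of m]
    by eventually_elim
      (simp add: x funpow_D_chain[OF assms(1)] linear_add[OF linear_funpow_D]
        linear_scale[OF linear_funpow_D])
qed

lemma chain_start_sum_eq_0_imp_eq_0:
  assumes "finite T" "T \<subseteq> S" "(\<Sum>t\<in>T. c t *\<^sub>R \<Lambda> t 0) = 0" "s \<in> T"
  shows "c s = 0"
proof -
  have "s \<in> S"
    using assms by blast
  then have \<epsilon>: "linear (\<epsilon> s)"
    by (rule linear_functional)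
  have "0 = \<epsilon> s (\<Sum>t\<in>T. c t *\<^sub>R \<Lambda> t 0)"
    by (simp add: assms(3) linear_0[OF \<epsilon>])
  also have "\<dots> = (\<Sum>t\<in>T. c t * \<epsilon> s (\<Lambda> t 0))"
    by (simp add: linear_sum[OF \<epsilon>] linear_scale[OF \<epsilon>])
  also have "\<dots> = (\<Sum>t\<in>T. if t = s then c s else 0)"
    using assms(2) \<open>s \<in> S\<close>
    by (intro sum.cong refl) (auto simp: functional_chain functional_other_chain_0)
  finally show ?thesis
    using assms(1,4) by simp
qed

lemma chain_space_sum_eq_0_imp_eq_0:
  assumes T: "finite T" "T \<subseteq> S"
    and "\<And>t. t \<in> T \<Longrightarrow> u t \<in> chain_space t" "(\<Sum>t\<in>T. u t) = 0"
      "\<And>t. t \<in> T \<Longrightarrow> (D ^^ n) (u t) = 0" "s \<in> T"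
  shows "u s = 0"
  using assms(3-)
proof (induction n arbitrary: u s)
  case 0
  then show ?case by simp
next
  case (Suc n)
  have "(\<Sum>t\<in>T. D (u t)) = 0"
    using Suc.prems(2) by (simp add: linear_0[OF linear_D] flip: linear_sum[OF linear_D])
  then have "D (u t) = 0" if "t \<in> T" for t
    using Suc.IH[of "\<lambda>t. D (u t)"] Suc.prems T(2) that
    by (auto simp: funpow_swap1 intro!: D_in_chain_space)
  then have u_eq: "u t = \<epsilon> t (u t) *\<^sub>R \<Lambda> t 0" if "t \<in> T" for t
    using chain_space_taylor[of t "u t" 0] Suc.prems(1) T(2) that by auto
  then have "(\<Sum>t\<in>T. \<epsilon> t (u t) *\<^sub>R \<Lambda> t 0) = 0"
    using Suc.prems(2) by simp
  then have "\<epsilon> s (u s) = 0"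
    using Suc.prems(4) by (rule chain_start_sum_eq_0_imp_eq_0[OF T])
  then show ?case
    using u_eq[OF Suc.prems(4)] by simp
qed

lemma independent_chain_spaces: "independent_subspaces S chain_space"
  unfolding independent_subspaces_def
proof (intro conjI ballI allI impI)
  show "subspace (chain_space s)" for s
    by (simp add: chain_space_def)
next
  fix T u s
  assume T: "finite T" "T \<subseteq> S" and u: "\<forall>t\<in>T. u t \<in> chain_space t" "(\<Sum>t\<in>T. u t) = 0" and s: "s \<in> T"
  have "\<forall>\<^sub>F n in sequentially. \<forall>t\<in>T. (D ^^ n) (u t) = 0"
    using T u(1) by (intro eventually_ball_finite ballI eventually_funpow_D_chain_space_eq_0) auto
  then obtain n where "\<forall>t\<in>T. (D ^^ n) (u t) = 0"
    by (auto dest: eventually_happens)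
  then show "u s = 0"
    using chain_space_sum_eq_0_imp_eq_0[OF T] u s by blast
qed

lemma component_chain_sum:
  assumes T: "finite T" "T \<subseteq> S" and s: "s \<in> S"
    and c: "\<And>t k. t \<in> S - T \<Longrightarrow> k \<in> I \<Longrightarrow> c k t = 0"
    and w: "w = (\<Sum>t\<in>T. \<Sum>k\<in>I. c k t *\<^sub>R \<Lambda> t k)"
  shows "component s w = (\<Sum>k\<in>I. c k s *\<^sub>R \<Lambda> s k)"
proof -
  let ?u = "\<lambda>t. if t \<in> S then \<Sum>k\<in>I. c k t *\<^sub>R \<Lambda> t k else 0"
  have "direct_sum_decomposition S chain_space w ?u"
  proof (rule direct_sum_decompositionI[OF T])
    show "w = (\<Sum>t\<in>T. ?u t)"
      unfolding w by (rule sum.cong) (use T(2) in auto)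
  qed (simp_all add: chain_sum_in_chain_space c)
  then have "component s w = ?u s"
    unfolding component_def by (rule direct_sum_proj_eq[OF independent_chain_spaces])
  with s show ?thesis by simp
qed

end

locale integrated_dual_chains = dual_chains D S \<Lambda> \<epsilon>
  for D :: "'v::real_vector \<Rightarrow> 'v"
    and S :: "'s set"
    and \<Lambda> :: "'s \<Rightarrow> nat \<Rightarrow> 'v"
    and \<epsilon> :: "'s \<Rightarrow> 'v \<Rightarrow> real" +
  fixes R :: "'v \<Rightarrow> 'v"
  assumes linear_R: "linear R"
    and R_chain: "s \<in> S \<Longrightarrow> R (\<Lambda> s m) = \<Lambda> s (Suc m)"
begin

definition initial_coefficients ::
  "nat \<Rightarrow> 'v \<Rightarrow> (nat \<Rightarrow> 's set) \<Rightarrow> (nat \<Rightarrow> 's \<Rightarrow> real) \<Rightarrow> bool" where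
  "initial_coefficients n w T c \<longleftrightarrow> (\<forall>k\<le>n. T k \<subseteq> S \<and> finite (T k) \<and>
     initial_op D R ((D ^^ k) w) = (\<Sum>s\<in>T k. c k s *\<^sub>R \<Lambda> s 0) \<and> (\<forall>s\<in>S - T k. c k s = 0))"

lemma initial_coefficients_expansion:
  assumes ker: "(D ^^ Suc n) w = 0" and coeffs: "initial_coefficients n w T c"
  shows "w = (\<Sum>s\<in>(\<Union>k\<le>n. T k). \<Sum>k\<le>n. c k s *\<^sub>R \<Lambda> s k)"
proof -
  let ?T = "\<Union>k\<le>n. T k"
  have T: "finite ?T" "?T \<subseteq> S"
    using coeffs by (auto simp: initial_coefficients_def)
  have funpow_R: "(R ^^ k) (\<Lambda> s 0) = \<Lambda> s k" if "s \<in> S" for s k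
    by (induction k) (simp_all add: R_chain[OF that])
  have funpow_R_initial_op:
    "(R ^^ k) (initial_op D R ((D ^^ k) w)) = (\<Sum>s\<in>?T. c k s *\<^sub>R \<Lambda> s k)" if "k \<le> n" for k
  proof -
    have T_k: "T k \<subseteq> S" "\<forall>s\<in>S - T k. c k s = 0"
      and "initial_op D R ((D ^^ k) w) = (\<Sum>s\<in>T k. c k s *\<^sub>R \<Lambda> s 0)"
      using coeffs that by (auto simp: initial_coefficients_def)
    then have "(R ^^ k) (initial_op D R ((D ^^ k) w)) = (\<Sum>s\<in>T k. c k s *\<^sub>R (R ^^ k) (\<Lambda> s 0))"
      using linear_funpow[OF linear_R, of k] by (simp add: linear_sum linear_scale)
    also have "\<dots> = (\<Sum>s\<in>T k. c k s *\<^sub>R \<Lambda> s k)"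
      using T_k by (intro sum.cong refl) (auto simp: funpow_R)
    also have "\<dots> = (\<Sum>s\<in>?T. c k s *\<^sub>R \<Lambda> s k)"
      using T T_k(2) that by (intro sum.mono_neutral_left) auto
    finally show ?thesis .
  qed
  have "w = (\<Sum>k\<le>n. (R ^^ k) (initial_op D R ((D ^^ k) w)))"
    using funpow_initial_op_expansion[OF linear_R, of w D "Suc n"] ker
      linear_0[OF linear_funpow[OF linear_R]]
    by (simp only: lessThan_Suc_atMost add_0_right)
  also have "\<dots> = (\<Sum>k\<le>n. \<Sum>s\<in>?T. c k s *\<^sub>R \<Lambda> s k)"
    by (simp add: funpow_R_initial_op)
  also have "\<dots> = (\<Sum>s\<in>?T. \<Sum>k\<le>n. c k s *\<^sub>R \<Lambda> s k)"
    by (rule sum.swap)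
  finally show ?thesis .
qed

lemma taylor_formula:
  assumes ker: "(D ^^ Suc n) w = 0" and coeffs: "initial_coefficients n w T c"
  shows "w = (\<Sum>s\<in>(\<Union>k\<le>n. T k). component s w)"
    and "\<And>k s. k \<le> n \<Longrightarrow> s \<in> S \<Longrightarrow> c k s = \<epsilon> s ((D ^^ k) (component s w))"
    and "\<And>s. s \<in> (\<Union>k\<le>n. T k) \<Longrightarrow>
      component s w = (\<Sum>k\<le>n. \<epsilon> s ((D ^^ k) (component s w)) *\<^sub>R \<Lambda> s k)"
    and "w = (\<Sum>s\<in>(\<Union>k\<le>n. T k). \<Sum>k\<le>n. \<epsilon> s ((D ^^ k) (component s w)) *\<^sub>R \<Lambda> s k)"
proof -
  let ?T = "\<Union>k\<le>n. T k"
  have T: "finite ?T" "?T \<subseteq> S"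
    using coeffs by (auto simp: initial_coefficients_def)
  have c_0: "c k s = 0" if "s \<in> S - ?T" "k \<in> {..n}" for s k
    using coeffs that by (auto simp: initial_coefficients_def)
  have component: "component s w = (\<Sum>k\<le>n. c k s *\<^sub>R \<Lambda> s k)" if "s \<in> S" for s
    using component_chain_sum[OF T that c_0 initial_coefficients_expansion[OF ker coeffs]] .
  show coeff: "c k s = \<epsilon> s ((D ^^ k) (component s w))" if "k \<le> n" "s \<in> S" for k s
    using that by (simp add: component functional_funpow_chain_sum)
  show taylor: "component s w = (\<Sum>k\<le>n. \<epsilon> s ((D ^^ k) (component s w)) *\<^sub>R \<Lambda> s k)"
    if "s \<in> ?T" for s
  proof -
    have s: "s \<in> S" using that T(2) by blast
    show ?thesis by (subst (1) component[OF s]) (simp add: coeff s)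
  qed
  have "w = (\<Sum>s\<in>?T. \<Sum>k\<le>n. c k s *\<^sub>R \<Lambda> s k)"
    by (rule initial_coefficients_expansion[OF ker coeffs])
  also have "\<dots> = (\<Sum>s\<in>?T. component s w)"
    using T(2) by (intro sum.cong refl) (auto simp: component)
  finally show "w = \<dots>" .
  also have "\<dots> = (\<Sum>s\<in>?T. \<Sum>k\<le>n. \<epsilon> s ((D ^^ k) (component s w)) *\<^sub>R \<Lambda> s k)"
    by (rule sum.cong[OF refl taylor])
  finally show "w = \<dots>" .
qed

end

section \<open>The chains of the quantum derivative\<close>

lemma Lambda_at_point:
  assumes "z q = 1"
  shows "Lambda \<sigma> \<tau> \<theta> s0 t0 z q m q = (if m = 0 then 1 else 0)"
proof (induction m rule: less_induct)
  case (less m)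
  show ?case
  proof (cases m)
    case 0
    then show ?thesis using assms by simp
  next
    case (Suc n)
    let ?z = "zeta_pow \<sigma> \<tau> \<theta> s0 t0 z q" and ?L = "Lambda \<sigma> \<tau> \<theta> s0 t0 z q"
    have "?L m q = ?z m q - (\<Sum>i=0..n. ?z (m - i) q * ?L i q)"
      using Suc by (simp add: linear_sum[OF linear_fun_apply] scaleR_fun_def)
    also have "(\<Sum>i=0..n. ?z (m - i) q * ?L i q) = (\<Sum>i=0..n. if i = 0 then ?z m q else 0)"
      using Suc less by (intro sum.cong) auto
    finally show ?thesis
      using Suc by simp
  qed
qed

lemma integrated_dual_chains_Lambda:
  assumes \<Lambda>_eq: "\<And>s m. \<Lambda> s m = Lambda \<sigma> \<tau> \<theta> s0 t0 (\<zeta> s) (q s) m"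
    and basis: "basis_family S \<zeta> (kernel (qderiv \<sigma> \<tau> \<theta>))"
    and normalized: "\<And>s. s \<in> S \<Longrightarrow> \<zeta> s (q s) = 1"
    and vanish: "\<And>s t. s \<in> S \<Longrightarrow> t \<in> S \<Longrightarrow> s \<noteq> t \<Longrightarrow> \<zeta> s (q t) = 0"
    and R: "right_inverse (qderiv \<sigma> \<tau> \<theta>) R"
    and R_\<Lambda>: "\<And>s m. s \<in> S \<Longrightarrow> R (\<Lambda> s m) = \<Lambda> s (m + 1)"
  shows "integrated_dual_chains (qderiv \<sigma> \<tau> \<theta>) S \<Lambda> (\<lambda>s f. f (q s)) R"
proof (rule integrated_dual_chains.intro[OF dual_chains.intro[OF linear_qderiv linear_fun_apply]
      integrated_dual_chains_axioms.intro])
  show "linear R"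
    using R by (simp add: right_inverse_def)
next
  fix s m assume s: "s \<in> S"
  show "R (\<Lambda> s m) = \<Lambda> s (Suc m)"
    using R_\<Lambda>[OF s] by simp
  then show "qderiv \<sigma> \<tau> \<theta> (\<Lambda> s (Suc m)) = \<Lambda> s m"
    using R by (metis right_inverse_def)
  have "\<zeta> s \<in> kernel (qderiv \<sigma> \<tau> \<theta>)"
    using basis s span_base[of "\<zeta> s" "\<zeta> ` S"] by (auto simp: basis_family_def)
  then show "qderiv \<sigma> \<tau> \<theta> (\<Lambda> s 0) = 0"
    by (simp add: \<Lambda>_eq kernel_def)
  show "\<Lambda> s m (q s) = (if m = 0 then 1 else 0)"
    unfolding \<Lambda>_eq by (rule Lambda_at_point[where z = "\<zeta> s", OF normalized[OF s]])
  show "\<Lambda> t 0 (q s) = 0" if "t \<in> S" "s \<noteq> t" for t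
    using vanish[OF that(1) s] that(2) by (simp add: \<Lambda>_eq)
qed

theorem mainTheorem2:
  fixes \<sigma> \<tau> :: "'m \<Rightarrow> 'm"
    and \<theta> :: "'m \<Rightarrow> 'm \<Rightarrow> real"
    and s0 t0 :: real
    and D R F :: "('m \<Rightarrow> real) \<Rightarrow> 'm \<Rightarrow> real"
    and S :: "'s set"
    and \<zeta> :: "'s \<Rightarrow> 'm \<Rightarrow> real"
    and q :: "'s \<Rightarrow> 'm"
    and \<Lambda> :: "'s \<Rightarrow> nat \<Rightarrow> 'm \<Rightarrow> real"
    and V :: "'s \<Rightarrow> ('m \<Rightarrow> real) set"
    and \<pi> :: "'s \<Rightarrow> ('m \<Rightarrow> real) \<Rightarrow> 'm \<Rightarrow> real"
    and n :: nat
    and W :: "'m \<Rightarrow> real"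
  assumes commute: "\<sigma> \<circ> \<tau> = \<tau> \<circ> \<sigma>"
    and bij: "bij \<sigma>"
    and tension: "tension \<theta>"
    and nonzero: "\<And>p. \<theta> (\<tau> p) (\<sigma> p) \<noteq> 0"
    and hom_\<sigma>: "homogeneous \<theta> \<sigma> s0"
    and hom_\<tau>: "homogeneous \<theta> \<tau> t0"
    and D_eq: "D = qderiv \<sigma> \<tau> \<theta>"
    and basis: "basis_family S \<zeta> (kernel D)"
    and normalized: "\<And>s. s \<in> S \<Longrightarrow> \<zeta> s (q s) = 1"
    and vanish: "\<And>s t. s \<in> S \<Longrightarrow> t \<in> S \<Longrightarrow> s \<noteq> t \<Longrightarrow> \<zeta> s (q t) = 0"
    and \<Lambda>_eq: "\<And>s m. \<Lambda> s m = Lambda \<sigma> \<tau> \<theta> s0 t0 (\<zeta> s) (q s) m"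
    and V_eq: "\<And>s. V s = span (range (\<Lambda> s))"
    and \<pi>_eq: "\<And>s. \<pi> s = direct_sum_proj S V s"
    and R_inv: "right_inverse D R"
    and R_\<Lambda>: "\<And>s m. s \<in> S \<Longrightarrow> R (\<Lambda> s m) = \<Lambda> s (m + 1)"
    and F_eq: "F = initial_op D R"
    and W: "W \<in> kernel (D ^^ (n + 1)) - kernel (D ^^ n)"
  shows
    "(\<forall>(SWk :: nat \<Rightarrow> 's set) (l :: nat \<Rightarrow> 's \<Rightarrow> real) SW.
        (\<forall>k\<le>n. SWk k \<subseteq> S \<and> finite (SWk k) \<and>
           F ((D ^^ k) W) = (\<Sum>s\<in>SWk k. l k s *\<^sub>R \<zeta> s) \<and>
           (\<forall>s\<in>S - SWk k. l k s = 0)) \<and>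
        SW = (\<Union>k\<le>n. SWk k)
        \<longrightarrow>
        W = (\<Sum>s\<in>SW. \<pi> s W) \<and>
        (\<forall>k\<le>n. \<forall>s\<in>S. l k s = (D ^^ k) (\<pi> s W) (q s)) \<and>
        (\<forall>s\<in>SW. \<pi> s W = (\<Sum>k=0..n. (D ^^ k) (\<pi> s W) (q s) *\<^sub>R \<Lambda> s k)) \<and>
        W = (\<Sum>s\<in>SW. \<Sum>k=0..n. (D ^^ k) (\<pi> s W) (q s) *\<^sub>R \<Lambda> s k))
     \<and> (\<forall>s\<in>S. W \<in> V s \<longrightarrow> W = (\<Sum>k=0..n. (D ^^ k) W (q s) *\<^sub>R \<Lambda> s k))"
proof -
  interpret integrated_dual_chains D S \<Lambda> "\<lambda>s f. f (q s)" R
    unfolding D_eq using \<Lambda>_eq basis[unfolded D_eq] normalized vanish R_inv[unfolded D_eq] R_\<Lambda>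
    by (rule integrated_dual_chains_Lambda)
  have V: "V = chain_space"
    by (simp add: fun_eq_iff V_eq chain_space_def)
  have \<pi>: "\<pi> = component"
    by (rule ext) (simp only: \<pi>_eq V component_def)
  have ker: "(D ^^ Suc n) W = 0"
    using W by (simp add: kernel_def)
  show ?thesis
    unfolding V \<pi> atLeast0AtMost
  proof (intro conjI allI impI ballI)
    show "W = (\<Sum>k\<le>n. (D ^^ k) W (q s) *\<^sub>R \<Lambda> s k)" if "s \<in> S" "W \<in> chain_space s" for s
      using that ker by (rule chain_space_taylor)
  next
    fix SWk l SW
    assume "(\<forall>k\<le>n. SWk k \<subseteq> S \<and> finite (SWk k) \<and>
        F ((D ^^ k) W) = (\<Sum>s\<in>SWk k. l k s *\<^sub>R \<zeta> s) \<and> (\<forall>s\<in>S - SWk k. l k s = 0)) \<and>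
        SW = (\<Union>k\<le>n. SWk k)"
    then have coeffs: "initial_coefficients n W SWk l" and SW: "SW = (\<Union>k\<le>n. SWk k)"
      by (simp_all add: initial_coefficients_def F_eq \<Lambda>_eq)
    note taylor = taylor_formula[OF ker coeffs, folded SW]
    show "W = (\<Sum>s\<in>SW. component s W)"
      and "W = (\<Sum>s\<in>SW. \<Sum>k\<le>n. (D ^^ k) (component s W) (q s) *\<^sub>R \<Lambda> s k)"
      by (fact taylor)+
    show "l k s = (D ^^ k) (component s W) (q s)" if "k \<le> n" "s \<in> S" for k s
      using that by (rule taylor)
    show "component s W = (\<Sum>k\<le>n. (D ^^ k) (component s W) (q s) *\<^sub>R \<Lambda> s k)" if "s \<in> SW" for s
      using that by (rule taylor)
  qed
qed

end
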